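(* Let $R$ be a potential domain, $n\ge1$, and let $s$ be a non-zero $n$-dimensional sequence over $R$ indexed by $-\mathbb{N}^n$. If $s$ is eventually rectilinear, then for all $i\in\{1,\dots,n\}$ the ideal $\mathrm{Ann}(s)\cap R[X_i]$ of $R[X_i]$ is principal and has a unique monic generator.
   Context: A factorial domain (unique factorization domain) $R$ is called potential if for all $n\ge1$ the power series ring $R[[X_1^{-1},\dots,X_n^{-1}]]$ is factorial. $\mathbb{N}=\{0,1,2,\dots\}$; $P_n=R[X_1,\dots,X_n]$; $X^a=X_1^{a_1}\cdots X_n^{a_n}$. An $n$-dimensional sequence is a function $s:-\mathbb{N}^n\to R$, $a\mapsto s_a$. $P_n$ acts by right shifting: $(f\circ s)_b=\sum_af_as_{b-a}$ for $f=\sum_af_aX^a$ and $b\le\mathbf 0$ (componentwise order). $\mathrm{Ann}(s)=\{f\in P_n:f\circ s=0\}$. $s$ is eventually rectilinear (EVR) if for all $i\in\{1,\dots,n\}$ there is $f_i\in\mathrm{Ann}(s)\cap R[X_i]$ with $\deg f_i\ge1$. *)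

theory Defs
  imports
    "HOL-Algebra.Ring_Divisibility"
    "HOL-Algebra.Algebraic_Closure_Type"
    "HOL-Library.Poly_Mapping"
    "HOL-Computational_Algebra.Polynomial"
begin

text \<open>
  The ground ring $R$ is a type of class \<open>idom\<close>. Indices in $-\mathbb{N}^n$ are functions
  $b$ from \<open>nat\<close> to \<open>int\<close> that are nonpositive everywhere and vanish off the coordinates
  \<open>{1..n}\<close>.
\<close>

definition neg_orthant :: "nat \<Rightarrow> (nat \<Rightarrow> int) set" where
  "neg_orthant n = {b. (\<forall>i. b i \<le> 0) \<and> (\<forall>i. i \<notin> {1..n} \<longrightarrow> b i = 0)}"

text \<open>
  A function on $-\mathbb{N}^n$ is represented by its extension by zero, so that the
  $n$-dimensional sequences over $R$ are literally the carrier of the power series ring in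
  $X_1^{-1}, \dots, X_n^{-1}$ below, and being non-zero means being different from
  the constant zero function.
\<close>

definition nd_seqs :: "nat \<Rightarrow> ((nat \<Rightarrow> int) \<Rightarrow> 'a::zero) set" where
  "nd_seqs n = {s. \<forall>b. b \<notin> neg_orthant n \<longrightarrow> s b = 0}"

text \<open>
  The ring $R[[X_1^{-1},\dots,X_n^{-1}]]$. The product is the Cauchy product; its index
  set is finite for every $b$, and empty if $b$ is not in \<open>neg_orthant n\<close>.
\<close>

definition neg_power_series_ring :: "nat \<Rightarrow> ((nat \<Rightarrow> int) \<Rightarrow> 'a::comm_ring_1) ring" where
  "neg_power_series_ring n =
    \<lparr> carrier = nd_seqs n,
      monoid.mult = (\<lambda>s t b.
        \<Sum>(c, d) \<in> {(c, d). c \<in> neg_orthant n \<and> d \<in> neg_orthant n \<and> (\<lambda>i. c i + d i) = b}.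
          s c * t d),
      one = (\<lambda>b. if b = (\<lambda>_. 0) then 1 else 0),
      ring.zero = (\<lambda>_. 0),
      add = (\<lambda>s t b. s b + t b) \<rparr>"

definition potential_domain :: "'a::idom itself \<Rightarrow> bool" where
  "potential_domain _ \<longleftrightarrow>
    factorial_domain (ring_of_type_algebra :: 'a ring) \<and>
    (\<forall>n\<ge>1. factorial_domain (neg_power_series_ring n :: ((nat \<Rightarrow> int) \<Rightarrow> 'a) ring))"

text \<open>
  The exponent of a monomial is a finitely supported map from variable numbers to \<open>nat\<close>.
\<close>

type_synonym 'a mpoly = "(nat \<Rightarrow>\<^sub>0 nat) \<Rightarrow>\<^sub>0 'a"

definition polys :: "nat \<Rightarrow> 'a::zero mpoly set" where
  "polys n = {f. \<forall>a \<in> Poly_Mapping.keys f. Poly_Mapping.keys a \<subseteq> {1..n}}"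

text \<open>\<open>in_var i p\<close> is $p(X_i)$, so that the subring $R[X_i]$ is the range of \<open>in_var i\<close>.\<close>

definition in_var :: "nat \<Rightarrow> 'a::comm_ring_1 poly \<Rightarrow> 'a mpoly" where
  "in_var i p =
    (\<Sum>k\<le>degree p. Poly_Mapping.single (Poly_Mapping.single i k) (coeff p k))"

definition var_ring :: "nat \<Rightarrow> 'a::comm_ring_1 mpoly ring" where
  "var_ring i = ring_of_type_algebra\<lparr>carrier := range (in_var i)\<rparr>"

definition shift_act ::
  "nat \<Rightarrow> 'a::comm_ring_1 mpoly \<Rightarrow> ((nat \<Rightarrow> int) \<Rightarrow> 'a) \<Rightarrow> (nat \<Rightarrow> int) \<Rightarrow> 'a" where
  "shift_act n f s b =
    (if b \<in> neg_orthant n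
     then \<Sum>a \<in> Poly_Mapping.keys f.
            Poly_Mapping.lookup f a * s (\<lambda>i. b i - int (Poly_Mapping.lookup a i))
     else 0)"

definition Ann :: "nat \<Rightarrow> ((nat \<Rightarrow> int) \<Rightarrow> 'a::comm_ring_1) \<Rightarrow> 'a mpoly set" where
  "Ann n s = {f \<in> polys n. shift_act n f s = (\<lambda>_. 0)}"

definition eventually_rectilinear :: "nat \<Rightarrow> ((nat \<Rightarrow> int) \<Rightarrow> 'a::comm_ring_1) \<Rightarrow> bool" where
  "eventually_rectilinear n s \<longleftrightarrow>
    (\<forall>i\<in>{1..n}. \<exists>p. degree p \<ge> 1 \<and> in_var i p \<in> Ann n s)"

end

theory Submission
  imports Defs
begin

text \<open>
  An element of $R[X_i]$ acts on \<open>s\<close> by acting separately on each of the one-dimensional sequences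
  $k \mapsto s_{b - k e_i}$. So the ideal in question is the common annihilator \<open>I\<close> in $R[X]$ of
  a shift-invariant set \<open>T\<close> of one-dimensional sequences over \<open>R\<close>. It contains a nonzero
  polynomial because \<open>s\<close> is eventually rectilinear, and $cf \in I$ with $c \neq 0$ implies
  $f \in I$ because \<open>R\<close> is a domain. Let \<open>d\<close> be the least degree of a nonzero element of \<open>I\<close>.
  Once \<open>I\<close> is known to contain a monic polynomial of degree \<open>d\<close>, division with remainder shows
  that this polynomial generates \<open>I\<close>, and a monic generator of an ideal of $R[X]$ is unique.

  The monic polynomial comes from unique factorisation in \<open>R\<close>, by an argument in the manner of
  Fatou's lemma. Take any $p \in I$ of degree \<open>d\<close>. The claim is that a prime \<open>\<pi>\<close> dividing the
  leading coefficient of \<open>p\<close> divides all of \<open>p\<close>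
  (\<open>prime_dvd_lead_coeff_imp_dvd\<close>); then \<open>p\<close> can be divided by \<open>\<pi>\<close> within \<open>I\<close>, and after finitely
  many steps the leading coefficient is a unit (\<open>ex_monic_annihilator\<close>).

  To prove the claim, assume that \<open>\<pi>\<close> does not divide \<open>p\<close>, and let $e < d$ be the degree of \<open>p\<close>
  modulo \<open>\<pi>\<close>. By minimality of \<open>d\<close>, the coordinates $0, \dots, d-1$ satisfy no linear relation
  on \<open>T\<close>. Hence linear elimination (\<open>ex_annihilator_of_degree\<close>) produces a sequence \<open>u\<close> over \<open>R\<close>
  that is annihilated by \<open>p\<close> and its shifts, with $u_0 = \dots = u_{d-2} = 0$ and
  $u_{d-1} \neq 0$. Modulo \<open>\<pi>\<close>, the recurrence given by \<open>p\<close> has order \<open>e\<close>, and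
  \<open>u\<close> starts with at least \<open>e\<close> zeros, so \<open>u\<close> vanishes modulo \<open>\<pi>\<close>. The sequence $u / \pi$
  has the same properties, so every power of \<open>\<pi>\<close> divides $u_{d-1}$
  (\<open>prime_power_dvd_recurrence\<close>), which is impossible in a factorial domain.
\<close>

section \<open>Prime factorisation in a factorial domain\<close>

text \<open>
  Translation of the carrier-based notion of a factorial domain into the type-class
  vocabulary of \<^const>\<open>prime_elem\<close> and divisibility. Irreducible elements of a factorial monoid
  are prime, so the factors can be taken to be primes; the unit \<open>e\<close> is there to cover
  units, which correspond to the empty list.
\<close>

lemma factorial_domain_prime_factorization:
  fixes c :: "'a::idom"
  assumes fact: "factorial_domain (ring_of_type_algebra :: 'a ring)" and c: "c \<noteq> 0"
  shows "\<exists>e fs. e dvd 1 \<and> (\<forall>f\<in>set fs. prime_elem f) \<and> c = e * prod_list fs"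
proof -
  let ?R = "ring_of_type_algebra :: 'a ring"
  interpret R: factorial_domain ?R by (rule fact)
  have ops: "carrier ?R = UNIV" "monoid.mult ?R = (*)" "\<one>\<^bsub>?R\<^esub> = 1" "\<zero>\<^bsub>?R\<^esub> = 0"
    by (simp_all add: ring_of_type_algebra_def)
  have nz: "y \<noteq> 0" if "x * y = 1 \<or> y * x = 1" for x y :: 'a
    using that by auto
  have unit: "x \<in> Units ?R \<longleftrightarrow> x dvd 1" for x
    unfolding Units_def by (auto simp: ops dvd_def mult.commute nz)
  have divides: "x divides\<^bsub>mult_of ?R\<^esub> y \<longleftrightarrow> x dvd y" if "y \<noteq> 0" for x y
    using that by (auto simp: factor_def ops dvd_def)
  have prime: "prime_elem f" if "Divisibility.irreducible (mult_of ?R) f" "f \<noteq> 0" for f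
  proof -
    have "Divisibility.prime (mult_of ?R) f"
      using factorial_monoid.irreducible_prime[OF R.factorial_monoid_axioms that(1)] that(2) by (simp add: ops)
    then have nu: "\<not> f dvd 1"
      and dv: "\<And>a b. a \<noteq> 0 \<Longrightarrow> b \<noteq> 0 \<Longrightarrow> f dvd a * b \<Longrightarrow> f dvd a \<or> f dvd b"
      by (auto simp: Divisibility.prime_def unit ops divides)
    show ?thesis
      unfolding prime_elem_def
    proof (intro conjI allI impI)
      fix a b assume "f dvd a * b"
      then show "f dvd a \<or> f dvd b" using dv[of a b] by (cases "a = 0 \<or> b = 0") auto
    qed (use that(2) nu in auto)
  qed
  show ?thesis
  proof (cases "c dvd 1")
    case True
    then show ?thesis by (intro exI[of _ c] exI[of _ "[]"]) simp
  next
    case False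
    then obtain fs where fs: "set fs \<subseteq> carrier (mult_of ?R)" "factors (mult_of ?R) fs c"
      using factorial_monoid.factors_exist[OF R.factorial_monoid_axioms, of c] c unit by (auto simp: ops)
    have foldr: "foldr (*) xs (1::'a) = prod_list xs" for xs
      by (induction xs) simp_all
    have "c = prod_list fs"
      using fs(2) by (simp add: factors_def ops foldr)
    moreover have "\<forall>f\<in>set fs. prime_elem f"
      using fs prime by (auto simp: factors_def ops)
    ultimately show ?thesis by (intro exI[of _ 1] exI[of _ fs]) simp
  qed
qed

lemma prime_elem_power_dvd_mult_cancel:
  fixes \<pi> :: "'a::idom"
  assumes "prime_elem \<pi>" "\<not> \<pi> dvd x" "\<pi> ^ n dvd x * y"
  shows "\<pi> ^ n dvd y"
  using assms(3)
proof (induction n arbitrary: y)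
  case (Suc n)
  have "\<pi> dvd x * y" using Suc.prems dvd_mult_left[of \<pi> "\<pi> ^ n"] by simp
  then have "\<pi> dvd y" using prime_elem_dvd_multD[OF assms(1)] assms(2) by blast
  then obtain z where z: "y = \<pi> * z" ..
  have "\<pi> * \<pi> ^ n dvd \<pi> * (x * z)" using Suc.prems unfolding z by (simp add: mult.left_commute)
  then have "\<pi> ^ n dvd x * z"
    using prime_elem_not_zeroI[OF assms(1)] unfolding dvd_mult_cancel_left by simp
  from Suc.IH[OF this] show ?case unfolding z power_Suc by (rule mult_dvd_mono[OF dvd_refl])
qed simp

text \<open>
  Each prime factor absorbs at most one factor \<open>\<pi>\<close>: if \<open>f = \<pi> * x\<close> is prime and \<open>\<pi>\<close> is not a
  unit, then \<open>x\<close> is a unit.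
\<close>

lemma prime_elem_power_not_dvd_prod_list:
  fixes e :: "'a::idom"
  assumes \<pi>: "prime_elem \<pi>" and e: "e dvd 1" and fs: "\<forall>f\<in>set fs. prime_elem f"
  shows "\<not> \<pi> ^ Suc (length fs) dvd e * prod_list fs"
  using fs
proof (induction fs)
  case Nil
  then show ?case using prime_elem_not_unit[OF \<pi>] dvd_trans[OF _ e, of \<pi>] by auto
next
  case (Cons f fs)
  let ?n = "Suc (length fs)"
  have f: "prime_elem f" and IH: "\<not> \<pi> ^ ?n dvd e * prod_list fs"
    using Cons by simp_all
  show ?case
  proof
    assume "\<pi> ^ Suc (length (f # fs)) dvd e * prod_list (f # fs)"
    then have dvd: "\<pi> ^ Suc ?n dvd f * (e * prod_list fs)" by (simp add: mult_ac)
    have "\<pi> dvd f"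
    proof (rule ccontr)
      assume "\<not> \<pi> dvd f"
      from prime_elem_power_dvd_mult_cancel[OF \<pi> this dvd] IH show False
        using dvd_mult_right[of \<pi> "\<pi> ^ ?n"] by simp
    qed
    then obtain x where x: "f = \<pi> * x" ..
    have "\<pi> \<noteq> 0" "f \<noteq> 0" using \<pi> f prime_elem_not_zeroI by blast+
    have "\<not> \<pi> dvd x"
    proof
      assume "\<pi> dvd x"
      have "f dvd \<pi> \<or> f dvd x" using prime_elem_dvd_multD[OF f, of \<pi> x] x by simp
      then have "\<pi> * x dvd \<pi> * 1 \<or> x * \<pi> dvd x * 1" using x by (simp add: mult_ac)
      moreover have "x \<noteq> 0" using x \<open>f \<noteq> 0\<close> by auto
      ultimately have "x dvd 1 \<or> \<pi> dvd 1"
        using \<open>\<pi> \<noteq> 0\<close> unfolding dvd_mult_cancel_left by blast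
      then show False
        using dvd_trans[OF \<open>\<pi> dvd x\<close>, of 1] prime_elem_not_unit[OF \<pi>] by blast
    qed
    have "\<pi> * \<pi> ^ ?n dvd \<pi> * (x * (e * prod_list fs))"
      using dvd by (simp add: x mult_ac)
    then have "\<pi> ^ ?n dvd x * (e * prod_list fs)"
      unfolding dvd_mult_cancel_left using \<open>\<pi> \<noteq> 0\<close> by simp
    from prime_elem_power_dvd_mult_cancel[OF \<pi> \<open>\<not> \<pi> dvd x\<close> this] IH show False by blast
  qed
qed

lemma factorial_domain_prime_power_not_dvd:
  fixes c \<pi> :: "'a::idom"
  assumes "factorial_domain (ring_of_type_algebra :: 'a ring)" "prime_elem \<pi>" "c \<noteq> 0"
  shows "\<exists>n. \<not> \<pi> ^ n dvd c"
proof -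
  obtain e fs where "e dvd 1" "\<forall>f\<in>set fs. prime_elem f" and c: "c = e * prod_list fs"
    using factorial_domain_prime_factorization[OF assms(1,3)] by blast
  from prime_elem_power_not_dvd_prod_list[OF assms(2) this(1,2)] show ?thesis
    unfolding c by (rule exI)
qed

section \<open>Annihilators of one-dimensional sequences\<close>

text \<open>
  The value at index \<open>0\<close> of the shift action of a polynomial on a one-dimensional sequence,
  where \<open>u k\<close> stands for the entry at $-k$. For sets of sequences that are closed under
  shifts, vanishing of all these values is the same as annihilation.
\<close>

definition pairing :: "'a::comm_ring_1 poly \<Rightarrow> (nat \<Rightarrow> 'a) \<Rightarrow> 'a" where
  "pairing p u = (\<Sum>k\<le>degree p. coeff p k * u k)"

definition annihilator :: "(nat \<Rightarrow> 'a::comm_ring_1) set \<Rightarrow> 'a poly set" where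
  "annihilator T = {p. \<forall>u\<in>T. pairing p u = 0}"

lemma pairing_bound: "degree p \<le> N \<Longrightarrow> pairing p u = (\<Sum>k\<le>N. coeff p k * u k)"
  unfolding pairing_def by (rule sum.mono_neutral_left) (auto simp: coeff_eq_0)

lemma pairing_0 [simp]: "pairing 0 u = 0"
  by (simp add: pairing_def)

lemma pairing_add: "pairing (p + q) u = pairing p u + pairing q u"
proof -
  let ?N = "max (degree p) (degree q)"
  show ?thesis
    by (simp add: pairing_bound[of _ ?N] degree_add_le sum.distrib algebra_simps)
qed

lemma pairing_smult: "pairing (smult a p) u = a * pairing p u"
  by (simp add: pairing_bound[of _ "degree p"] degree_smult_le sum_distrib_left mult.assoc)

lemma pairing_pCons: "pairing (pCons a p) u = a * u 0 + pairing p (\<lambda>k. u (Suc k))"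
proof -
  have "pairing (pCons a p) u = (\<Sum>k\<le>Suc (degree p). coeff (pCons a p) k * u k)"
    by (rule pairing_bound) (rule degree_pCons_le)
  then show ?thesis by (simp add: sum.atMost_Suc_shift pairing_def del: sum.atMost_Suc)
qed

lemma pairing_diff_right:
  "pairing p (\<lambda>k. a * u k - b * v k) = a * pairing p u - b * pairing p v"
  by (simp add: pairing_def sum_distrib_left sum_subtractf algebra_simps)

lemma annihilator_add: "p \<in> annihilator T \<Longrightarrow> q \<in> annihilator T \<Longrightarrow> p + q \<in> annihilator T"
  by (simp add: annihilator_def pairing_add)

lemma annihilator_smult: "p \<in> annihilator T \<Longrightarrow> smult a p \<in> annihilator T"
  by (simp add: annihilator_def pairing_smult)

lemma annihilator_smult_cancel:
  fixes p :: "'a::idom poly"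
  shows "smult a p \<in> annihilator T \<Longrightarrow> a \<noteq> 0 \<Longrightarrow> p \<in> annihilator T"
  by (simp add: annihilator_def pairing_smult)

lemma annihilator_mult:
  assumes shift: "\<And>u. u \<in> T \<Longrightarrow> (\<lambda>k. u (Suc k)) \<in> T" and p: "p \<in> annihilator T"
  shows "q * p \<in> annihilator T"
proof (induction q)
  case 0
  then show ?case by (simp add: annihilator_def)
next
  case (pCons a q)
  have "pCons 0 (q * p) \<in> annihilator T"
    using pCons.IH shift by (simp add: annihilator_def pairing_pCons)
  then show ?case
    using annihilator_add[OF annihilator_smult[OF p, of a]] by simp
qed

section \<open>Linear elimination and recurrences modulo a prime\<close>

text \<open>
  Gaussian elimination without division. If the first \<open>m\<close> entries of a member of the module \<open>S\<close>
  cannot vanish unless the next one does, then the coordinates \<open>0..m\<close> satisfy a linear relation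
  on \<open>S\<close> that involves coordinate \<open>m\<close>; its coefficients form the polynomial \<open>h\<close>. The induction
  eliminates coordinate \<open>0\<close>.
\<close>

lemma ex_annihilator_of_degree:
  fixes S :: "(nat \<Rightarrow> 'a::idom) set"
  assumes "\<And>a b u v. u \<in> S \<Longrightarrow> v \<in> S \<Longrightarrow> (\<lambda>k. a * u k - b * v k) \<in> S"
    and "\<And>u. u \<in> S \<Longrightarrow> \<forall>j<m. u j = 0 \<Longrightarrow> u m = 0"
  shows "\<exists>h\<in>annihilator S. h \<noteq> 0 \<and> degree h = m"
  using assms
proof (induction m arbitrary: S)
  case 0
  have "1 \<in> annihilator S" using "0.prems"(2) by (simp add: annihilator_def pairing_def)
  then show ?case by (intro bexI[of _ 1]) simp_all
next
  case (Suc m)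
  note lin = Suc.prems(1)
  define S' where "S' = {\<lambda>k. u (Suc k) | u. u \<in> S \<and> u 0 = 0}"
  have "\<exists>h\<in>annihilator S'. h \<noteq> 0 \<and> degree h = m"
  proof (rule Suc.IH)
    fix a b u v assume "u \<in> S'" "v \<in> S'"
    then obtain x y where "u = (\<lambda>k. x (Suc k))" "v = (\<lambda>k. y (Suc k))" "x \<in> S" "y \<in> S" "x 0 = 0" "y 0 = 0"
      unfolding S'_def by auto
    then show "(\<lambda>k. a * u k - b * v k) \<in> S'"
      unfolding S'_def using lin[of x y a b] by (auto intro!: exI[of _ "\<lambda>k. a * x k - b * y k"])
  next
    fix u assume "u \<in> S'" "\<forall>j<m. u j = 0"
    then show "u m = 0"
      using Suc.prems(2) unfolding S'_def by (auto simp: less_Suc_eq_0_disj)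
  qed
  then obtain h where h: "h \<in> annihilator S'" "h \<noteq> 0" "degree h = m" by blast
  have h0: "pairing h (\<lambda>k. u (Suc k)) = 0" if "u \<in> S" "u 0 = 0" for u
    using h(1) that unfolding annihilator_def S'_def by blast
  show ?case
  proof (cases "\<forall>u\<in>S. u 0 = 0")
    case True
    then have "pCons 0 h \<in> annihilator S"
      using h0 by (simp add: annihilator_def pairing_pCons)
    then show ?thesis using h by (intro bexI[of _ "pCons 0 h"]) auto
  next
    case False
    then obtain v where v: "v \<in> S" "v 0 \<noteq> 0" by blast
    \<comment> \<open>For \<open>u\<close> in \<open>S\<close>, the combination \<open>v 0 * u - u 0 * v\<close> starts with zero, so the shifted
      relation \<open>h\<close> holds for it. Sorting this relation by the entries of \<open>u\<close> gives \<open>?g\<close>.\<close>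
    let ?g = "pCons (- pairing h (\<lambda>k. v (Suc k))) (smult (v 0) h)"
    have "pairing ?g u = 0" if u: "u \<in> S" for u
      using h0[OF lin[OF u v(1), of "v 0" "u 0"]]
      by (simp add: pairing_diff_right pairing_pCons pairing_smult mult.commute)
    then have "?g \<in> annihilator S" by (simp add: annihilator_def)
    then show ?thesis using h v by (intro bexI[of _ ?g]) auto
  qed
qed

text \<open>
  Modulo \<open>\<pi>\<close> the recurrence has order \<open>e\<close>, and its leading coefficient \<open>coeff p e\<close> does not
  vanish. A solution that starts with \<open>e\<close> zeros is therefore zero modulo \<open>\<pi>\<close>. Dividing it by \<open>\<pi>\<close>
  gives another solution that starts with \<open>e\<close> zeros, and this can be repeated forever.
\<close>

lemma prime_power_dvd_recurrence:
  fixes p :: "'a::idom poly"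
  assumes prime: "prime_elem \<pi>"
    and e: "\<not> \<pi> dvd coeff p e" "\<And>k. k > e \<Longrightarrow> \<pi> dvd coeff p k"
    and rec: "\<And>k. pairing p (\<lambda>j. w (k + j)) = 0" and init: "\<And>j. j < e \<Longrightarrow> w j = 0"
  shows "\<pi> ^ n dvd w k"
  using rec init
proof (induction n arbitrary: w k)
  case 0
  then show ?case by simp
next
  case (Suc n)
  have "\<pi> dvd w k" for k
  proof (induction k rule: less_induct)
    case (less k)
    show ?case
    proof (cases "k < e")
      case True
      then show ?thesis using Suc.prems(2) by simp
    next
      case False
      let ?f = "\<lambda>j. coeff p j * w (k - e + j)"
      have e_le: "e \<le> degree p" using e(1) by (metis dvd_0_right le_degree)
      have "(\<Sum>j\<le>degree p. ?f j) = 0"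
        using Suc.prems(1)[of "k - e"] by (simp add: pairing_def)
      then have "?f e + (\<Sum>j\<in>{..degree p} - {e}. ?f j) = 0"
        using sum.remove[of "{..degree p}" e ?f] e_le by simp
      moreover have "\<pi> dvd (\<Sum>j\<in>{..degree p} - {e}. ?f j)"
      proof (rule dvd_sum)
        fix j assume "j \<in> {..degree p} - {e}"
        then consider "j < e" | "j > e" by fastforce
        then show "\<pi> dvd ?f j"
          using less[of "k - e + j"] e(2)[of j] False by cases auto
      qed
      ultimately have "\<pi> dvd ?f e"
        by (metis add_eq_0_iff dvd_minus_iff)
      then show ?thesis
        using prime e(1) False by (auto simp: prime_elem_dvd_mult_iff)
    qed
  qed
  then have "\<forall>k. \<exists>x. w k = \<pi> * x" by (auto simp: dvd_def)
  then obtain w' where w': "\<And>k. w k = \<pi> * w' k" by metis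
  have "\<pi> \<noteq> 0" using prime by (rule prime_elem_not_zeroI)
  have "\<pi> ^ n dvd w' k"
  proof (rule Suc.IH)
    fix k
    have "\<pi> * pairing p (\<lambda>j. w' (k + j)) = 0"
      using Suc.prems(1)[of k] by (simp add: w' pairing_def sum_distrib_left mult_ac)
    then show "pairing p (\<lambda>j. w' (k + j)) = 0" using \<open>\<pi> \<noteq> 0\<close> by simp
  next
    fix j assume "j < e"
    then show "w' j = 0" using Suc.prems(2)[of j] \<open>\<pi> \<noteq> 0\<close> by (simp add: w')
  qed
  then show ?case by (simp add: w' mult_dvd_mono)
qed

text \<open>
  The arithmetic heart of the proof, a variant of Fatou's lemma on rational power series.
  Let \<open>d = degree p\<close>, and suppose that \<open>\<pi>\<close> divides the leading coefficient of \<open>p\<close>, but not all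
  of its coefficients. Then \<open>p\<close> modulo \<open>\<pi>\<close> has a degree \<open>e < d\<close>. As no nonzero polynomial of
  degree \<open>d - 1\<close> annihilates \<open>T\<close>, elimination yields a sequence \<open>u\<close> that satisfies the same
  recurrence as \<open>T\<close> and starts with \<open>d - 1 \<ge> e\<close> zeros followed by a nonzero entry.
  This entry would be divisible by all powers of \<open>\<pi>\<close>.
\<close>

lemma prime_dvd_lead_coeff_imp_dvd:
  fixes p :: "'a::idom poly"
  assumes fact: "factorial_domain (ring_of_type_algebra :: 'a ring)"
    and shift: "\<And>u. u \<in> T \<Longrightarrow> (\<lambda>k. u (Suc k)) \<in> T"
    and p: "p \<in> annihilator T"
    and minimal: "\<And>q. q \<in> annihilator T \<Longrightarrow> q \<noteq> 0 \<Longrightarrow> degree p \<le> degree q"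
    and prime: "prime_elem \<pi>" and lead: "\<pi> dvd lead_coeff p"
  shows "\<pi> dvd coeff p k"
proof (rule ccontr)
  assume "\<not> \<pi> dvd coeff p k"
  define D where "D = {j. \<not> \<pi> dvd coeff p j}"
  have "D \<subseteq> {..degree p}" unfolding D_def by (auto intro: le_degree)
  then have fin: "finite D" by (rule finite_subset) simp
  define e where "e = Max D"
  have "e \<in> D" unfolding e_def using fin \<open>\<not> \<pi> dvd coeff p k\<close> by (intro Max_in) (auto simp: D_def)
  then have e: "\<not> \<pi> dvd coeff p e" "e \<le> degree p" "e \<noteq> degree p"
    using lead \<open>D \<subseteq> _\<close> by (auto simp: D_def)
  have above: "\<pi> dvd coeff p j" if "j > e" for j
    using Max_ge[OF fin, of j] that unfolding e_def[symmetric] by (auto simp: D_def)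
  \<comment> \<open>The double annihilator of \<open>T\<close>: it is a module closed under shifts that has the same
    annihilator as \<open>T\<close>, which makes elimination applicable. As \<open>e < degree p\<close>, the subtraction in
    \<open>degree p - 1\<close> is not truncated.\<close>
  define S where "S = {u. \<forall>q\<in>annihilator T. pairing q u = 0}"
  have "\<exists>u\<in>S. (\<forall>j<degree p - 1. u j = 0) \<and> u (degree p - 1) \<noteq> 0"
  proof (rule ccontr)
    assume "\<not> ?thesis"
    then have "\<exists>h\<in>annihilator S. h \<noteq> 0 \<and> degree h = degree p - 1"
      by (intro ex_annihilator_of_degree) (auto simp: S_def pairing_diff_right)
    moreover have "annihilator S \<subseteq> annihilator T"
      by (auto simp: annihilator_def S_def)
    ultimately show False
      using minimal e by fastforce
  qed
  then obtain u where u: "u \<in> S" "\<And>j. j < degree p - 1 \<Longrightarrow> u j = 0" "u (degree p - 1) \<noteq> 0"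
    by blast
  have "pairing p (\<lambda>j. v (k + j)) = 0" if "v \<in> S" for k v
    using that
  proof (induction k arbitrary: v)
    case 0
    then show ?case using p by (simp add: S_def)
  next
    case (Suc k)
    have "pCons 0 q \<in> annihilator T" if "q \<in> annihilator T" for q
      using annihilator_mult[OF shift that, of "[:0, 1:]"] by simp
    then have "(\<lambda>k. v (Suc k)) \<in> S"
      using Suc.prems by (fastforce simp: S_def pairing_pCons)
    then show ?case using Suc.IH[of "\<lambda>k. v (Suc k)"] by simp
  qed
  then have "\<pi> ^ n dvd u (degree p - 1)" for n
    using u e by (intro prime_power_dvd_recurrence[OF prime e(1) above]) auto
  then show False
    using factorial_domain_prime_power_not_dvd[OF fact prime u(3)] by blast
qed

section \<open>Monic generators of annihilators\<close>

text \<open>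
  Every prime factor of the leading coefficient divides the whole polynomial and can be
  cancelled, because \<open>annihilator T\<close> is closed under division by nonzero constants. What remains
  is a polynomial with a unit as leading coefficient.
\<close>

lemma ex_monic_annihilator:
  fixes p :: "'a::idom poly"
  assumes fact: "factorial_domain (ring_of_type_algebra :: 'a ring)"
    and shift: "\<And>u. u \<in> T \<Longrightarrow> (\<lambda>k. u (Suc k)) \<in> T"
    and p: "p \<in> annihilator T" "p \<noteq> 0"
    and minimal: "\<And>q. q \<in> annihilator T \<Longrightarrow> q \<noteq> 0 \<Longrightarrow> degree p \<le> degree q"
  shows "\<exists>q\<in>annihilator T. lead_coeff q = 1 \<and> degree q = degree p"
proof -
  obtain e fs where e: "e dvd 1" "\<forall>f\<in>set fs. prime_elem f" "lead_coeff p = e * prod_list fs"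
    using factorial_domain_prime_factorization[OF fact] p(2) by (metis leading_coeff_0_iff)
  show ?thesis
    using e(2,3) p minimal
  proof (induction fs arbitrary: p)
    case Nil
    obtain x where x: "1 = e * x" using e(1) by (auto simp: dvd_def)
    then have "x \<noteq> 0" by auto
    then show ?case
      using Nil annihilator_smult[of p T x] x by (intro bexI[of _ "smult x p"]) (auto simp: mult.commute)
  next
    case (Cons f fs)
    have f: "prime_elem f" "f \<noteq> 0" using Cons.prems(1) prime_elem_not_zeroI[of f] by auto
    have "f dvd coeff p k" for k
      by (rule prime_dvd_lead_coeff_imp_dvd[OF fact shift Cons.prems(3,5) f(1)])
        (simp_all add: Cons.prems(2))
    then obtain r where r: "p = smult f r"
      using const_poly_dvd_iff[of f p] by (auto elim: dvdE)
    have "\<exists>q\<in>annihilator T. lead_coeff q = 1 \<and> degree q = degree r"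
    proof (rule Cons.IH)
      show "\<forall>f\<in>set fs. prime_elem f" using Cons.prems(1) by simp
      show "lead_coeff r = e * prod_list fs"
        using Cons.prems(2) f(2) by (simp add: r)
      show "r \<in> annihilator T"
        using Cons.prems(3) f(2) by (simp add: r annihilator_smult_cancel[of f])
      show "r \<noteq> 0" using Cons.prems(4) by (auto simp: r)
      show "degree r \<le> degree q" if "q \<in> annihilator T" "q \<noteq> 0" for q
        using Cons.prems(5)[OF that] f(2) by (simp add: r)
    qed
    then show ?case using f(2) by (simp add: r)
  qed
qed

text \<open>
  Division with remainder by a monic polynomial needs no inverses in \<open>R\<close>. If the divisor is a monic
  annihilator of minimal degree, the remainder of another annihilator must be zero. Two monic
  generators divide each other, so the quotient is a unit with leading coefficient \<open>1\<close>.
\<close>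

lemma ex1_monic_annihilator_generator:
  fixes p :: "'a::idom poly"
  assumes fact: "factorial_domain (ring_of_type_algebra :: 'a ring)"
    and shift: "\<And>u. u \<in> T \<Longrightarrow> (\<lambda>k. u (Suc k)) \<in> T"
    and p: "p \<in> annihilator T" "p \<noteq> 0"
  shows "\<exists>!g. lead_coeff g = 1 \<and> annihilator T = {q * g | q. True}"
proof -
  obtain m where m: "m \<in> annihilator T" "m \<noteq> 0"
    "\<And>q. q \<in> annihilator T \<Longrightarrow> q \<noteq> 0 \<Longrightarrow> degree m \<le> degree q"
    using ex_has_least_nat[of "\<lambda>q. q \<in> annihilator T \<and> q \<noteq> 0" p degree] p by blast
  obtain g where g: "g \<in> annihilator T" "lead_coeff g = 1" "degree g = degree m"
    using ex_monic_annihilator[OF fact shift m] by blast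
  have dvd: "g dvd f" if f: "f \<in> annihilator T" for f
  proof -
    obtain q r where qr: "pseudo_divmod f g = (q, r)" by force
    have "g \<noteq> 0" using g(2) by auto
    then have *: "f = g * q + r" "r = 0 \<or> degree r < degree g"
      using pseudo_divmod[OF _ qr] g(2) by simp_all
    have "r = f + (- q) * g" using *(1) by (simp add: algebra_simps)
    then have "r \<in> annihilator T"
      using annihilator_add[OF f annihilator_mult[OF shift g(1), of "- q"]] by (simp only:)
    then have "r = 0" using *(2) m(3)[of r] g(3) by fastforce
    then show ?thesis using *(1) by simp
  qed
  show ?thesis
  proof (rule ex1I[of _ g])
    show "lead_coeff g = 1 \<and> annihilator T = {q * g | q. True}"
      using g(2) dvd annihilator_mult[OF shift g(1)] by (blast elim: dvdE intro: mult.commute)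
  next
    fix h assume h: "lead_coeff h = 1 \<and> annihilator T = {q * h | q. True}"
    then have "h \<in> annihilator T" using mult_1_left[of h] by (metis (mono_tags, lifting) mem_Collect_eq)
    then obtain a where a: "h = g * a" using dvd by (auto simp: dvd_def)
    obtain b where b: "g = b * h" using g(1) h by auto
    have "g * (a * b) = g * 1" using a b by (simp add: mult_ac)
    then have "a * b = 1" using g(2) by (metis leading_coeff_0_iff mult_left_cancel zero_neq_one)
    then have "degree a + degree b = 0" by (metis degree_1 degree_mult_eq mult_eq_0_iff zero_neq_one)
    then obtain x where x: "a = [:x:]" by (auto elim: degree_eq_zeroE)
    have "lead_coeff a = 1" using a g(2) h by (simp add: lead_coeff_mult)
    then have "a = 1" using x by (simp add: one_pCons)
    then show "h = g" using a by simp
  qed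
qed

section \<open>The subring of polynomials in one variable\<close>

text \<open>
  Since \<^const>\<open>in_var\<close> is an injective ring homomorphism for each variable, ideals of $R[X_i]$ can
  be computed in the ring of univariate polynomials. Its values are determined by their
  coefficients at the powers of $X_i$, which are pairwise distinct monomials.
\<close>

lemma inj_single: "inj (Poly_Mapping.single i :: nat \<Rightarrow> nat \<Rightarrow>\<^sub>0 nat)"
  by (rule injI) (metis lookup_single_eq)

lemma in_var_bound:
  "degree p \<le> N \<Longrightarrow>
    in_var i p = (\<Sum>k\<le>N. Poly_Mapping.single (Poly_Mapping.single i k) (coeff p k))"
  unfolding in_var_def by (rule sum.mono_neutral_left) (auto simp: coeff_eq_0)

lemma in_var_add: "in_var i (p + q) = in_var i p + in_var i q"
proof -
  let ?N = "max (degree p) (degree q)"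
  show ?thesis
    by (simp add: in_var_bound[of _ ?N] degree_add_le sum.distrib single_add)
qed

lemma in_var_0 [simp]: "in_var i 0 = 0"
  by (simp add: in_var_def)

lemma in_var_const: "in_var i [:a:] = Poly_Mapping.single 0 a"
  by (simp add: in_var_def)

lemma in_var_shift:
  "in_var i (pCons 0 p) = Poly_Mapping.single (Poly_Mapping.single i 1) 1 * in_var i p"
proof -
  have "in_var i (pCons 0 p) =
      (\<Sum>k\<le>Suc (degree p). Poly_Mapping.single (Poly_Mapping.single i k) (coeff (pCons 0 p) k))"
    by (rule in_var_bound) (rule degree_pCons_le)
  then show ?thesis
    by (simp add: sum.atMost_Suc_shift in_var_def sum_distrib_left mult_single
        flip: single_add del: sum.atMost_Suc)
qed

lemma in_var_mult: "in_var i (p * q) = in_var i p * in_var i q"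
proof (induction p)
  case 0
  then show ?case by simp
next
  case (pCons a p)
  have smult: "in_var i (smult a q) = Poly_Mapping.single 0 a * in_var i q"
    by (simp add: in_var_bound[of _ "degree q"] degree_smult_le sum_distrib_left mult_single)
  have "in_var i (pCons a p) = in_var i ([:a:] + pCons 0 p)" by simp
  then show ?case
    by (simp only: mult_pCons_left in_var_add in_var_const in_var_shift smult pCons.IH distrib_right mult.assoc)
qed

lemma lookup_in_var: "Poly_Mapping.lookup (in_var i p) (Poly_Mapping.single i k) = coeff p k"
proof -
  have "Poly_Mapping.lookup (in_var i p) (Poly_Mapping.single i k) =
      (\<Sum>l\<le>degree p. if l = k then coeff p l else 0)"
    unfolding in_var_def lookup_sum
    by (intro sum.cong) (auto simp: lookup_single when_def dest: injD[OF inj_single])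
  then show ?thesis by (auto simp: coeff_eq_0)
qed

lemma inj_in_var: "inj (in_var i)"
proof (rule injI)
  fix p q :: "'a poly"
  assume "in_var i p = in_var i q"
  then show "p = q" by (intro poly_eqI) (metis lookup_in_var)
qed

lemma keys_in_var: "Poly_Mapping.keys (in_var i p) \<subseteq> Poly_Mapping.single i ` {..degree p}"
  unfolding in_var_def by (rule order_trans[OF keys_sum]) auto

lemma in_var_in_polys: "i \<in> {1..n} \<Longrightarrow> in_var i p \<in> polys n"
  using keys_in_var[of i p] by (fastforce simp: polys_def split: if_splits)

section \<open>Reduction to one-dimensional sequences\<close>

text \<open>
  The one-dimensional sequences $k \mapsto s_{b - k e_i}$ that \<open>s\<close> induces on the rays parallel
  to the \<open>i\<close>-th axis, where $e_i$ is the \<open>i\<close>-th unit vector.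
\<close>

definition slices :: "nat \<Rightarrow> nat \<Rightarrow> ((nat \<Rightarrow> int) \<Rightarrow> 'a) \<Rightarrow> (nat \<Rightarrow> 'a) set" where
  "slices n i s =
    (\<lambda>b k. s (\<lambda>j. b j - int (Poly_Mapping.lookup (Poly_Mapping.single i k) j))) ` neg_orthant n"

lemma slices_shift:
  assumes i: "i \<in> {1..n}" and u: "u \<in> slices n i s"
  shows "(\<lambda>k. u (Suc k)) \<in> slices n i s"
proof -
  obtain b where b: "b \<in> neg_orthant n"
    and u: "u = (\<lambda>k. s (\<lambda>j. b j - int (Poly_Mapping.lookup (Poly_Mapping.single i k) j)))"
    using u by (auto simp: slices_def)
  let ?c = "\<lambda>j. b j - int (Poly_Mapping.lookup (Poly_Mapping.single i 1) j)"
  have "?c \<in> neg_orthant n"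
    using b i by (auto simp: neg_orthant_def lookup_single when_def intro: order_trans[of _ 0])
  moreover have "(\<lambda>k. u (Suc k)) =
      (\<lambda>k. s (\<lambda>j. ?c j - int (Poly_Mapping.lookup (Poly_Mapping.single i k) j)))"
    unfolding u by (intro ext arg_cong[of _ _ s]) (auto simp: lookup_single when_def)
  ultimately show ?thesis
    unfolding slices_def by (intro image_eqI[where x = ?c]) simp_all
qed

lemma shift_act_in_var:
  assumes "b \<in> neg_orthant n"
  shows "shift_act n (in_var i p) s b =
    pairing p (\<lambda>k. s (\<lambda>j. b j - int (Poly_Mapping.lookup (Poly_Mapping.single i k) j)))"
proof -
  let ?g = "\<lambda>a. Poly_Mapping.lookup (in_var i p) a * s (\<lambda>j. b j - int (Poly_Mapping.lookup a j))"
  have "shift_act n (in_var i p) s b = sum ?g (Poly_Mapping.keys (in_var i p))"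
    using assms by (simp add: shift_act_def)
  also have "\<dots> = sum ?g (Poly_Mapping.single i ` {..degree p})"
    by (rule sum.mono_neutral_left[OF _ keys_in_var]) (auto simp: in_keys_iff)
  also have "\<dots> = (\<Sum>k\<le>degree p. ?g (Poly_Mapping.single i k))"
    by (rule sum.reindex[unfolded o_def]) (rule inj_on_subset[OF inj_single subset_UNIV])
  finally show ?thesis by (simp add: pairing_def lookup_in_var)
qed

text \<open>
  A polynomial in $X_i$ moves indices only along the \<open>i\<close>-th axis. It annihilates \<open>s\<close> if and only if
  it annihilates all slices, and this reduces the claim to dimension one.
\<close>

lemma Ann_Int_range_in_var:
  assumes "i \<in> {1..n}"
  shows "Ann n s \<inter> range (in_var i) = in_var i ` annihilator (slices n i s)"
proof -
  have "in_var i p \<in> Ann n s \<longleftrightarrow> p \<in> annihilator (slices n i s)" for p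
  proof -
    have "in_var i p \<in> Ann n s \<longleftrightarrow> (\<forall>b\<in>neg_orthant n. shift_act n (in_var i p) s b = 0)"
      using in_var_in_polys[OF assms, of p] by (auto simp: Ann_def fun_eq_iff shift_act_def)
    also have "\<dots> \<longleftrightarrow> p \<in> annihilator (slices n i s)"
      by (simp add: annihilator_def slices_def shift_act_in_var)
    finally show ?thesis .
  qed
  then show ?thesis by auto
qed

lemma cring_var_ring: "cring (var_ring i :: 'a::comm_ring_1 mpoly ring)"
proof -
  let ?R = "ring_of_type_algebra :: 'a mpoly ring"
  interpret R: cring ?R by (rule cring_from_type_algebra)
  have ops: "carrier ?R = UNIV" "monoid.mult ?R = (*)" "\<one>\<^bsub>?R\<^esub> = 1" "\<zero>\<^bsub>?R\<^esub> = 0" "add ?R = (+)"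
    by (simp_all add: ring_of_type_algebra_def)
  have minus: "\<ominus>\<^bsub>?R\<^esub> f = - f" for f
    using R.minus_equality[of "- f" f] by (simp add: ops)
  have neg: "- in_var i p = in_var i (- p)" for p :: "'a poly"
    using in_var_add[of i p "- p"] by (simp add: eq_neg_iff_add_eq_0 add.commute neg_eq_iff_add_eq_0)
  have "subring (range (in_var i)) ?R"
  proof (rule R.subringI)
    show "\<one>\<^bsub>?R\<^esub> \<in> range (in_var i)"
      unfolding ops using in_var_const[of i 1] by (metis rangeI single_one)
  qed (auto simp: ops minus neg simp flip: in_var_add in_var_mult)
  then show ?thesis
    unfolding var_ring_def by (intro R.subcring_iff[THEN iffD1] R.subcringI') (simp_all add: ops)
qed

lemma genideal_var_ring:
  "genideal (var_ring i) {in_var i g} = in_var i ` {q * g | q. True}"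
proof -
  interpret V: cring "var_ring i :: 'a mpoly ring" by (rule cring_var_ring)
  have V: "carrier (var_ring i) = range (in_var i)" "monoid.mult (var_ring i :: 'a mpoly ring) = (*)"
    by (simp_all add: var_ring_def ring_of_type_algebra_def)
  have "genideal (var_ring i) {in_var i g} = cgenideal (var_ring i) (in_var i g)"
    by (rule V.cgenideal_eq_genideal[symmetric]) (simp add: V)
  also have "\<dots> = in_var i ` {q * g | q. True}"
    by (auto simp: cgenideal_def V in_var_mult full_SetCompr_eq image_image)
  finally show ?thesis .
qed

theorem theorem4p12:
  fixes s :: "(nat \<Rightarrow> int) \<Rightarrow> 'a::idom" and n :: nat
  assumes "potential_domain TYPE('a)"
    and "n \<ge> 1"
    and "s \<in> nd_seqs n"
    and "s \<noteq> (\<lambda>_. 0)"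
    and "eventually_rectilinear n s"
  shows "\<forall>i\<in>{1..n}.
    principalideal (Ann n s \<inter> range (in_var i)) (var_ring i) \<and>
    (\<exists>!p. lead_coeff p = 1 \<and>
      Ann n s \<inter> range (in_var i) = genideal (var_ring i) {in_var i p})"
proof
  fix i assume i: "i \<in> {1..n}"
  let ?T = "slices n i s"
  interpret V: cring "var_ring i :: 'a mpoly ring" by (rule cring_var_ring)
  have fact: "factorial_domain (ring_of_type_algebra :: 'a ring)"
    using assms(1) by (simp add: potential_domain_def)
  obtain p where "degree p \<ge> 1" "in_var i p \<in> Ann n s"
    using assms(5) i unfolding eventually_rectilinear_def by blast
  then have "in_var i p \<in> in_var i ` annihilator ?T" "p \<noteq> 0"
    using Ann_Int_range_in_var[OF i, of s] by auto
  then have p: "p \<in> annihilator ?T" "p \<noteq> 0"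
    by (simp_all add: inj_image_mem_iff[OF inj_in_var])
  have iff: "Ann n s \<inter> range (in_var i) = genideal (var_ring i) {in_var i g} \<longleftrightarrow>
      annihilator ?T = {q * g | q. True}" for g
    unfolding Ann_Int_range_in_var[OF i] genideal_var_ring
    by (rule inj_image_eq_iff[OF inj_in_var])
  have unique: "\<exists>!g. lead_coeff g = 1 \<and>
      Ann n s \<inter> range (in_var i) = genideal (var_ring i) {in_var i g}"
    unfolding iff by (rule ex1_monic_annihilator_generator[OF fact slices_shift[OF i] p])
  then obtain g where "Ann n s \<inter> range (in_var i) = genideal (var_ring i) {in_var i g}"
    by blast
  moreover have "in_var i g \<in> carrier (var_ring i)"
    by (simp add: var_ring_def)
  ultimately have "principalideal (Ann n s \<inter> range (in_var i)) (var_ring i)"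
    by (auto intro!: principalidealI V.genideal_ideal)
  with unique show "principalideal (Ann n s \<inter> range (in_var i)) (var_ring i) \<and>
    (\<exists>!p. lead_coeff p = 1 \<and>
      Ann n s \<inter> range (in_var i) = genideal (var_ring i) {in_var i p})"
    by blast
qed

end
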